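(* Let $X$ be a Markov process on a finite set $\Omega_0$ with intensity matrix $\lambda$. Let $a,b\subset\Omega_0$ with $a\cap b=\emptyset$. Define $\tau_a=\inf\{u: X_u\in a\}$ and $d=a\cup b$. Let $\alpha$ (a row vector) be the initial distribution of $X$, with $\alpha(i)=0$ for all $i\in d$. Then for $u>0$ $$\frac{d}{du}\Big[P_\alpha\big(\tau_a\in(0,u],\ X_v\notin b \text{ for all } v\le\tau_a\big)\Big]=\alpha\, e^{u\boldsymbol{\lambda}(d^c)}\,\boldsymbol{\lambda}(d^c,a)\,\mathbf{1}.$$
   Context: $\Omega_0$ is a finite set and $X=(X_u)_{u\ge 0}$ is an $\Omega_0$-valued continuous time process (right-continuous, piecewise constant paths) on a measurable space $(\Omega,\mathscr{F})$ with measures $P_i$, $i\in\Omega_0$, such that $P_i(X_0=i)=1$ and under each $P_i$, $X$ is a time-homogeneous Markov process with intensity matrix $\lambda$ (with $-\lambda(i,i)=\sum_{j\ne i}\lambda(i,j)$). For a probability distribution $\alpha$ on $\Omega_0$, $P_\alpha=\sum_i\alpha(i)P_i$. For $A,B\subset\Omega_0$, $\boldsymbol{\lambda}(A,B)$ is the $\Omega_0\times\Omega_0$ matrix whose $(i,j)$ entry is $\lambda(i,j)$ if $i\in A$, $j\in B$, and $0$ otherwise; $\boldsymbol{\lambda}(A)=\boldsymbol{\lambda}(A,A)$. $d^c=\Omega_0\setminus d$; $\mathbf 1$ is the column vector of ones indexed by $\Omega_0$. *)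

theory Defs
  imports "HOL-Probability.Probability"
begin

text \<open>The operation \<open>(^)\<close> on \<open>real^'s^'s\<close> is the entrywise power, so powers of matrices are
  written as iterated matrix products.\<close>

definition matrix_exp :: "real^'s^'s \<Rightarrow> real^'s^('s::finite)" where
  "matrix_exp A = (\<Sum>n. (1 / fact n) *\<^sub>R (((**) A ^^ n) (mat 1)))"

definition submat :: "real^'s^'s \<Rightarrow> 's set \<Rightarrow> 's set \<Rightarrow> real^'s^('s::finite)" where
  "submat \<Lambda> A B = (\<chi> i j. if i \<in> A \<and> j \<in> B then \<Lambda> $ i $ j else 0)"

definition intensity_matrix :: "real^'s^('s::finite) \<Rightarrow> bool" where
  "intensity_matrix \<Lambda> \<longleftrightarrow>
     (\<forall>i j. i \<noteq> j \<longrightarrow> 0 \<le> \<Lambda> $ i $ j) \<and> (\<forall>i. - \<Lambda> $ i $ i = (\<Sum>j\<in>UNIV - {i}. \<Lambda> $ i $ j))"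

definition transition_semigroup :: "(real \<Rightarrow> real^'s^('s::finite)) \<Rightarrow> bool" where
  "transition_semigroup p \<longleftrightarrow>
     (\<forall>t\<ge>0. \<forall>i j. 0 \<le> p t $ i $ j) \<and>
     (\<forall>t\<ge>0. \<forall>i. (\<Sum>j\<in>UNIV. p t $ i $ j) = 1) \<and>
     p 0 = mat 1 \<and>
     (\<forall>s\<ge>0. \<forall>t\<ge>0. p (s + t) = p s ** p t)"

text \<open>Processes are functions on \<open>real\<close>; only their values at times \<open>u \<ge> 0\<close> are meaningful.\<close>

definition past :: "'w measure \<Rightarrow> (real \<Rightarrow> 'w \<Rightarrow> 's) \<Rightarrow> real \<Rightarrow> 'w measure" where
  "past M X t = sigma (space M) {X s -` A \<inter> space M | s A. 0 \<le> s \<and> s \<le> t}"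

text \<open>\<open>P(X\<^bsub>t+h\<^esub> = k | X\<^sub>s, s \<le> t) = p\<^sub>h(X\<^sub>t, k)\<close> almost surely, where \<open>\<Lambda>\<close> is the right derivative
  at time 0 of the transition semigroup \<open>p\<close>.\<close>

definition homogeneous_markov :: "'w measure \<Rightarrow> (real \<Rightarrow> 'w \<Rightarrow> 's::finite) \<Rightarrow> real^'s^'s \<Rightarrow> bool" where
  "homogeneous_markov M X \<Lambda> \<longleftrightarrow>
     (\<exists>p. transition_semigroup p \<and>
          (p has_vector_derivative \<Lambda>) (at 0 within {0..}) \<and>
          (\<forall>t\<ge>0. \<forall>h\<ge>0. \<forall>k. AE \<omega> in M.
             real_cond_exp M (past M X t) (indicator {\<omega> \<in> space M. X (t + h) \<omega> = k}) \<omega>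
               = p h $ X t \<omega> $ k))"

text \<open>Right continuity is with respect to the discrete topology of the state space; a path is
  piecewise constant if it has finitely many jumps in every bounded time interval.\<close>

definition rc_piecewise_constant :: "(real \<Rightarrow> 's) \<Rightarrow> bool" where
  "rc_piecewise_constant x \<longleftrightarrow>
     (\<forall>t\<ge>0. \<forall>\<^sub>F s in at_right t. x s = x t) \<and>
     (\<forall>T. finite {t \<in> {0<..T}. \<not> (\<forall>\<^sub>F s in at t. x s = x t)})"

locale markov_process =
  fixes M :: "'w measure"
    and P :: "'s::finite \<Rightarrow> 'w measure"
    and X :: "real \<Rightarrow> 'w \<Rightarrow> 's"
    and \<Lambda> :: "real^'s^'s"
  assumes prob_space_P: "\<And>i. prob_space (P i)"
    and sets_P: "\<And>i. sets (P i) = sets M"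
    and measurable_X: "\<And>u. 0 \<le> u \<Longrightarrow> X u \<in> measurable M (count_space UNIV)"
    and paths: "\<And>\<omega>. \<omega> \<in> space M \<Longrightarrow> rc_piecewise_constant (\<lambda>u. X u \<omega>)"
    and start: "\<And>i. measure (P i) {\<omega> \<in> space M. X 0 \<omega> = i} = 1"
    and intensity: "intensity_matrix \<Lambda>"
    and markov: "\<And>i. homogeneous_markov (P i) X \<Lambda>"

definition prob_vector :: "real^('s::finite) \<Rightarrow> bool" where
  "prob_vector \<alpha> \<longleftrightarrow> (\<forall>i. 0 \<le> \<alpha> $ i) \<and> (\<Sum>i\<in>UNIV. \<alpha> $ i) = 1"

definition mixture :: "'w measure \<Rightarrow> ('s::finite \<Rightarrow> 'w measure) \<Rightarrow> real^'s \<Rightarrow> 'w measure" where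
  "mixture M P \<alpha> =
     measure_of (space M) (sets M) (\<lambda>A. \<Sum>i\<in>UNIV. ennreal (\<alpha> $ i) * emeasure (P i) A)"

text \<open>Extended-real valued: the hitting time is \<open>\<infinity>\<close> on paths that never visit \<open>a\<close>.\<close>

definition hitting_time :: "(real \<Rightarrow> 'w \<Rightarrow> 's) \<Rightarrow> 's set \<Rightarrow> 'w \<Rightarrow> ereal" where
  "hitting_time X a \<omega> = Inf (ereal ` {u. 0 \<le> u \<and> X u \<omega> \<in> a})"

end

theory Submission imports Defs begin

text \<open>Observe the process only at the times \<open>k t / n\<close>. By right continuity, for large \<open>n\<close> the skeleton
  enters \<open>a\<close> directly from \<open>S = d\<^sup>c\<close> iff the path does so by time \<open>t\<close>, hence the probabilities
  converge. For the skeleton they only involve the transition matrix \<open>p\<^sub>h\<close> with \<open>h = t / n\<close>. Let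
  \<open>w(s)\<close> be the antiderivative of \<open>e\<^bsup>s\<lambda>(S)\<^esup> \<lambda>(S, a) 1\<close> vanishing at 0; then \<open>w' = \<lambda>(S, a) 1 + \<lambda>(S) w\<close>, so
  one step of the skeleton changes the expected value of ``already hit, plus \<open>w\<close> of the remaining time
  at the current state'' by at most \<open>o(h)\<close>. Summing the \<open>n = t / h\<close> steps, the probability of
  the event started from \<open>i\<close> is \<open>w\<^sub>i(t)\<close>.\<close>

section \<open>The Markov property integrated over events of the past\<close>

lemma subalgebra_past:
  assumes X: "\<And>u. 0 \<le> u \<Longrightarrow> X u \<in> measurable N (count_space UNIV)"
  shows "subalgebra N (past N X t)"
proof -
  have "{X s -` A \<inter> space N | s A. 0 \<le> s \<and> s \<le> t} \<subseteq> sets N"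
    using X by (auto intro!: measurable_sets)
  moreover have "sets (past N X t) = sigma_sets (space N) {X s -` A \<inter> space N | s A. 0 \<le> s \<and> s \<le> t}"
    unfolding past_def by (intro sets_measure_of) auto
  ultimately show ?thesis
    using sets.sigma_sets_subset by (simp add: subalgebra_def past_def space_measure_of_conv)
qed

text \<open>\<open>G\<close> belongs to the past, so the indicator of the future event and its
  conditional expectation have the same integral over \<open>G\<close>. The present state on
  \<open>G\<close> is \<open>m\<close>, which makes the conditional expectation a.s. equal to the
  constant \<open>p $ m $ j\<close> there.\<close>

lemma markov_step:
  fixes X :: "real \<Rightarrow> 'w \<Rightarrow> 's::finite"
  assumes N: "prob_space N"
    and X: "\<And>u. 0 \<le> u \<Longrightarrow> X u \<in> measurable N (count_space UNIV)"
    and markov: "AE \<omega> in N. real_cond_exp N (past N X t)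
          (indicator {\<omega> \<in> space N. X (t + h) \<omega> = j}) \<omega> = p $ X t \<omega> $ j"
    and t: "0 \<le> t" and h: "0 \<le> h"
    and G: "G \<in> sets (past N X t)"
    and G_at: "\<And>\<omega>. \<omega> \<in> G \<Longrightarrow> X t \<omega> = m"
  shows "measure N {\<omega> \<in> G. X (t + h) \<omega> = j} = p $ m $ j * measure N G"
proof -
  interpret prob_space N by (rule N)
  note sub = subalgebra_past[of X N t, OF X]
  interpret finite_measure_subalgebra N "past N X t"
    by unfold_locales (rule sub)
  have GN: "G \<in> sets N" using G sub by (auto simp: subalgebra_def)
  then have GS: "G \<subseteq> space N" by (rule sets.sets_into_space)
  let ?J = "{\<omega> \<in> space N. X (t + h) \<omega> = j}"
  have "X (t + h) -` {j} \<inter> space N \<in> sets N"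
    using X[of "t + h"] t h by (intro measurable_sets) auto
  then have J: "?J \<in> sets N" by (simp add: vimage_def Int_def conj_commute)
  have eq: "{\<omega> \<in> G. X (t + h) \<omega> = j} = G \<inter> ?J" using GS by auto
  have "measure N (G \<inter> ?J) = (\<integral>x\<in>G. indicator ?J x \<partial>N)"
    using GN J by (simp add: set_lebesgue_integral_def flip: indicator_inter_arith)
  also have "\<dots> = (\<integral>x\<in>G. real_cond_exp N (past N X t) (indicator ?J) x \<partial>N)"
    using G J by (intro real_cond_exp_intA) (auto simp: integrable_indicator_iff less_top[symmetric])
  also have "\<dots> = (\<integral>x\<in>G. p $ m $ j \<partial>N)"
    unfolding set_lebesgue_integral_def
  proof (rule integral_cong_AE)
    show "AE x in N. indicator G x *\<^sub>R real_cond_exp N (past N X t) (indicator ?J) x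
        = indicator G x *\<^sub>R p $ m $ j"
      using markov by eventually_elim (auto simp: indicator_def G_at)
  qed (use GN in auto)
  also have "\<dots> = p $ m $ j * measure N G"
    using GN by (simp add: set_lebesgue_integral_def)
  finally show ?thesis unfolding eq .
qed

section \<open>Events of the skeleton and their one-step recursions\<close>

text \<open>The hit occurs at step \<open>Suc k\<close>, never at step 0: a path starting in
  \<open>a\<close> does not count, which matches the strict bound
  \<open>0 < hitting_time X a \<omega>\<close>.\<close>

definition grid_hit :: "'w measure \<Rightarrow> (real \<Rightarrow> 'w \<Rightarrow> 's) \<Rightarrow> 's set \<Rightarrow> 's set \<Rightarrow> real \<Rightarrow> nat \<Rightarrow> 'w set" where
  "grid_hit N X S a h n =
     {\<omega> \<in> space N. \<exists>k<n. (\<forall>l\<le>k. X (real l * h) \<omega> \<in> S) \<and> X (real (Suc k) * h) \<omega> \<in> a}"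

text \<open>The event involves no time after \<open>k h\<close> and fixes the state at that time,
  the two demands that \<open>markov_step\<close> makes on \<open>G\<close>.\<close>

definition grid_stay :: "'w measure \<Rightarrow> (real \<Rightarrow> 'w \<Rightarrow> 's) \<Rightarrow> 's set \<Rightarrow> real \<Rightarrow> nat \<Rightarrow> 's \<Rightarrow> 'w set" where
  "grid_stay N X S h k m = {\<omega> \<in> space N. (\<forall>l\<le>k. X (real l * h) \<omega> \<in> S) \<and> X (real k * h) \<omega> = m}"

lemma sets_X_in:
  assumes "X u \<in> measurable N (count_space UNIV)"
  shows "{\<omega> \<in> space N. X u \<omega> \<in> A} \<in> sets N"
proof -
  have "X u -` A \<inter> space N \<in> sets N"
    using assms by (intro measurable_sets) auto
  then show ?thesis by (simp add: vimage_def Int_def conj_commute)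
qed

lemma sets_grid_hit:
  assumes X: "\<And>u. 0 \<le> u \<Longrightarrow> X u \<in> measurable N (count_space UNIV)" and "0 \<le> h"
  shows "grid_hit N X S a h n \<in> sets N"
proof -
  have *: "{\<omega> \<in> space N. X (real k * h) \<omega> \<in> A} \<in> sets N" for k A
    using X assms(2) by (intro sets_X_in) simp
  have "{\<omega> \<in> space N. \<exists>k\<in>{..<n}. (\<forall>l\<in>{..k}. X (real l * h) \<omega> \<in> S)
      \<and> X (real (Suc k) * h) \<omega> \<in> a} \<in> sets N"
    by (intro sets.sets_Collect_finite_Ex sets.sets_Collect_conj sets.sets_Collect_finite_All' *) auto
  then show ?thesis by (simp only: grid_hit_def Bex_def Ball_def lessThan_iff atMost_iff)
qed

lemma sets_grid_stay_past:
  assumes "0 \<le> h"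
  shows "grid_stay N X S h k m \<in> sets (past N X (real k * h))"
proof -
  let ?F = "past N X (real k * h)"
  have sp: "space ?F = space N" by (simp add: past_def space_measure_of_conv)
  have *: "{\<omega> \<in> space ?F. X (real l * h) \<omega> \<in> A} \<in> sets ?F" if "l \<le> k" for l A
  proof -
    have "X (real l * h) -` A \<inter> space N \<in> sets ?F"
      unfolding past_def using that assms
      by (subst sets_measure_of) (auto intro!: sigma_sets.Basic mult_right_mono exI[of _ "real l * h"])
    then show ?thesis by (simp add: sp vimage_def Int_def conj_commute)
  qed
  have "grid_stay N X S h k m
      = {\<omega> \<in> space ?F. (\<forall>l\<in>{..k}. X (real l * h) \<omega> \<in> S) \<and> X (real k * h) \<omega> \<in> {m}}"
    by (auto simp: grid_stay_def sp)
  also have "\<dots> \<in> sets ?F"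
    by (intro sets.sets_Collect_conj sets.sets_Collect_finite_All' *) (auto simp: *)
  finally show ?thesis .
qed

lemma sets_grid_stay:
  assumes X: "\<And>u. 0 \<le> u \<Longrightarrow> X u \<in> measurable N (count_space UNIV)" and "0 \<le> h"
  shows "grid_stay N X S h k m \<in> sets N"
  using sets_grid_stay_past[OF \<open>0 \<le> h\<close>, of N X S k m] subalgebra_past[of X N "real k * h", OF X]
  unfolding subalgebra_def by blast

text \<open>Both recursions split an event by the state \<open>m\<close> at step \<open>k\<close>
  and the state \<open>j\<close> at step \<open>Suc k\<close>. The pieces are disjoint, and
  \<open>markov_step\<close> evaluates each of them.\<close>

lemma
  fixes X :: "real \<Rightarrow> 'w \<Rightarrow> 's::finite"
  assumes N: "prob_space N"
    and X: "\<And>u. 0 \<le> u \<Longrightarrow> X u \<in> measurable N (count_space UNIV)"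
    and markov: "\<And>t k. 0 \<le> t \<Longrightarrow> AE \<omega> in N. real_cond_exp N (past N X t)
          (indicator {\<omega> \<in> space N. X (t + h) \<omega> = k}) \<omega> = p $ X t \<omega> $ k"
    and h: "0 \<le> h"
  shows measure_grid_stay_Suc: "j \<in> S \<Longrightarrow> measure N (grid_stay N X S h (Suc k) j)
      = (\<Sum>m\<in>S. p $ m $ j * measure N (grid_stay N X S h k m))"
    and measure_grid_hit_Suc: "a \<inter> S = {} \<Longrightarrow> measure N (grid_hit N X S a h (Suc k))
      = measure N (grid_hit N X S a h k)
        + (\<Sum>m\<in>S. (\<Sum>j\<in>a. p $ m $ j) * measure N (grid_stay N X S h k m))"
proof -
  interpret prob_space N by (rule N)
  let ?t = "real (Suc k) * h"
  let ?G = "\<lambda>m j. {\<omega> \<in> grid_stay N X S h k m. X ?t \<omega> = j}"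
  have meas: "?G m j \<in> sets N" for m j
  proof -
    have "?G m j = grid_stay N X S h k m \<inter> {\<omega> \<in> space N. X ?t \<omega> \<in> {j}}"
      by (auto simp: grid_stay_def)
    also have "\<dots> \<in> sets N"
      using X h by (intro sets.Int sets_grid_stay sets_X_in) auto
    finally show ?thesis .
  qed
  have step: "measure N (?G m j) = p $ m $ j * measure N (grid_stay N X S h k m)" for m j
  proof -
    have "?t = real k * h + h" by (simp add: algebra_simps)
    then show ?thesis
      using markov_step[where X = X and p = p and t = "real k * h" and h = h and m = m and j = j
          and G = "grid_stay N X S h k m", OF N X markov _ h sets_grid_stay_past[OF h]] h
      by (simp add: grid_stay_def)
  qed
  show "measure N (grid_stay N X S h (Suc k) j)
      = (\<Sum>m\<in>S. p $ m $ j * measure N (grid_stay N X S h k m))" if "j \<in> S"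
  proof -
    have "grid_stay N X S h (Suc k) j = (\<Union>m\<in>S. ?G m j)"
      using that by (auto simp: grid_stay_def le_Suc_eq)
    moreover have "measure N (\<Union>m\<in>S. ?G m j) = (\<Sum>m\<in>S. measure N (?G m j))"
    proof (rule finite_measure_finite_Union)
      show "disjoint_family_on (\<lambda>m. ?G m j) S"
        unfolding disjoint_family_on_def grid_stay_def by blast
    qed (use meas in auto)
    ultimately show ?thesis by (simp only: step)
  qed
  show "measure N (grid_hit N X S a h (Suc k)) = measure N (grid_hit N X S a h k)
        + (\<Sum>m\<in>S. (\<Sum>j\<in>a. p $ m $ j) * measure N (grid_stay N X S h k m))" if "a \<inter> S = {}"
  proof -
    let ?D = "\<Union>q\<in>S\<times>a. ?G (fst q) (snd q)"
    have "measure N ?D = (\<Sum>q\<in>S\<times>a. measure N (?G (fst q) (snd q)))"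
    proof (rule finite_measure_finite_Union)
      show "disjoint_family_on (\<lambda>q. ?G (fst q) (snd q)) (S \<times> a)"
        unfolding disjoint_family_on_def grid_stay_def by (auto simp del: of_nat_Suc)
    qed (use meas in auto)
    also have "\<dots> = (\<Sum>m\<in>S. (\<Sum>j\<in>a. p $ m $ j) * measure N (grid_stay N X S h k m))"
      by (simp add: step sum.cartesian_product' sum_distrib_right del: of_nat_Suc)
    finally have D: "measure N ?D = \<dots>" .
    have "grid_hit N X S a h (Suc k) = grid_hit N X S a h k \<union> ?D"
      by (auto simp: grid_hit_def grid_stay_def less_Suc_eq)
    moreover have "grid_hit N X S a h k \<inter> ?D = {}"
    proof -
      \<comment> \<open>A hit at step \<open>Suc l\<close>, which is at most \<open>k\<close>, puts
        the path in \<open>a\<close> at a time when a stay up to step \<open>k\<close> demands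
        \<open>S\<close>.\<close>
      have False if "l < k" "X (real (Suc l) * h) \<omega> \<in> a" "\<forall>l\<le>k. X (real l * h) \<omega> \<in> S" for l \<omega>
        using that \<open>a \<inter> S = {}\<close> by (metis Suc_leI disjoint_iff)
      then show ?thesis unfolding grid_hit_def grid_stay_def by blast
    qed
    moreover have "?D \<in> sets N" using meas by (intro sets.finite_UN) auto
    ultimately show ?thesis
      using sets_grid_hit[of X N h S a k, OF X h] D by (simp add: finite_measure_Union)
  qed
qed

text \<open>\<open>W k m\<close> is a guess for the probability of a hit within \<open>k\<close> steps from \<open>m\<close>; \<open>\<epsilon>\<close> bounds its defect
  in the one-step recursion.\<close>

lemma grid_hit_potential:
  fixes X :: "real \<Rightarrow> 'w \<Rightarrow> 's::finite"
  assumes N: "prob_space N"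
    and X: "\<And>u. 0 \<le> u \<Longrightarrow> X u \<in> measurable N (count_space UNIV)"
    and markov: "\<And>t k. 0 \<le> t \<Longrightarrow> AE \<omega> in N. real_cond_exp N (past N X t)
          (indicator {\<omega> \<in> space N. X (t + h) \<omega> = k}) \<omega> = p $ X t \<omega> $ k"
    and h: "0 \<le> h"
    and aS: "a \<inter> S = {}"
    and local: "\<And>k m. k < n \<Longrightarrow> m \<in> S \<Longrightarrow>
        \<bar>(\<Sum>j\<in>a. p $ m $ j) + (\<Sum>j\<in>S. p $ m $ j * W k j) - W (Suc k) m\<bar> \<le> \<epsilon>"
    and W0: "\<And>m. W 0 m = 0"
    and \<epsilon>: "0 \<le> \<epsilon>"
  shows "\<bar>measure N (grid_hit N X S a h n) - (\<Sum>m\<in>S. measure N (grid_stay N X S h 0 m) * W n m)\<bar>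
      \<le> real n * \<epsilon>"
proof -
  interpret prob_space N by (rule N)
  let ?r = "\<lambda>k m. measure N (grid_stay N X S h k m)"
  \<comment> \<open>This interpolates between the two quantities to be compared: at
    \<open>k = 0\<close> nothing has been hit yet, and at \<open>k = n\<close> the sum vanishes
    because \<open>W 0 = 0\<close>.\<close>
  let ?\<Phi> = "\<lambda>k. measure N (grid_hit N X S a h k) + (\<Sum>m\<in>S. ?r k m * W (n - k) m)"
  \<comment> \<open>The stay events for distinct \<open>m\<close> are disjoint, so weighting defects
    of size \<epsilon> by their probabilities gives at most \<epsilon>.\<close>
  have r_sum: "(\<Sum>m\<in>S. ?r k m) \<le> 1" for k
  proof -
    have "(\<Sum>m\<in>S. ?r k m) = measure N (\<Union>m\<in>S. grid_stay N X S h k m)"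
    proof (rule finite_measure_finite_Union[symmetric])
      show "disjoint_family_on (grid_stay N X S h k) S"
        unfolding disjoint_family_on_def grid_stay_def by blast
    qed (use sets_grid_stay[of X N h S k, OF X h] in auto)
    then show ?thesis by simp
  qed
  have step: "\<bar>?\<Phi> (Suc k) - ?\<Phi> k\<bar> \<le> \<epsilon>" if "k < n" for k
  proof -
    \<comment> \<open>\<open>l\<close> is the number of steps left after step
      \<open>Suc k\<close>.\<close>
    define l where "l = n - Suc k"
    have l: "n - k = Suc l" "l < n" using that by (auto simp: l_def)
    have "(\<Sum>j\<in>S. ?r (Suc k) j * W l j) = (\<Sum>j\<in>S. \<Sum>m\<in>S. ?r k m * (p $ m $ j * W l j))"
      by (simp add: measure_grid_stay_Suc[OF N X markov h] sum_distrib_left mult_ac)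
    also have "\<dots> = (\<Sum>m\<in>S. ?r k m * (\<Sum>j\<in>S. p $ m $ j * W l j))"
      by (subst sum.swap) (simp add: sum_distrib_left)
    \<comment> \<open>By the two recursions the increment is a weighted sum of the one-step defects
      bounded in \<open>local\<close>.\<close>
    finally have "?\<Phi> (Suc k) - ?\<Phi> k
        = (\<Sum>m\<in>S. ?r k m * ((\<Sum>j\<in>a. p $ m $ j) + (\<Sum>j\<in>S. p $ m $ j * W l j) - W (Suc l) m))"
      using measure_grid_hit_Suc[OF N X markov h aS, of k] unfolding l(1) l_def[symmetric]
      by (simp add: algebra_simps sum.distrib sum_subtractf)
    also have "\<bar>\<dots>\<bar> \<le> (\<Sum>m\<in>S. ?r k m * \<epsilon>)"
      by (intro order_trans[OF sum_abs] sum_mono)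
        (auto simp: abs_mult intro!: mult_left_mono local l(2))
    also have "\<dots> \<le> \<epsilon>"
      using mult_right_mono[OF r_sum[of k] \<epsilon>] by (simp add: sum_distrib_right)
    finally show ?thesis .
  qed
  have "\<bar>?\<Phi> k - ?\<Phi> 0\<bar> \<le> real k * \<epsilon>" if "k \<le> n" for k
    using that
  proof (induction k)
    case (Suc k)
    then show ?case using step[of k] by (simp add: algebra_simps)
  qed simp
  from this[of n] show ?thesis by (simp add: W0 grid_hit_def[of _ _ _ _ _ 0])
qed

section \<open>Path analysis: first entrance times and fine grids\<close>

text \<open>The infimum \<tau> of the visit times is attained: the path is constant on some interval
  from \<tau> to \<open>c\<close>, so if \<open>x \<tau>\<close> were outside \<open>A\<close>, no
  visit would occur before \<open>c\<close>, and the infimum would be at least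
  \<open>c\<close>.\<close>

lemma first_entrance:
  fixes x :: "real \<Rightarrow> 's"
  assumes rc: "\<And>t. 0 \<le> t \<Longrightarrow> \<forall>\<^sub>F s in at_right t. x s = x t"
    and v: "0 \<le> v" "x v \<in> A"
  obtains \<tau> where "0 \<le> \<tau>" "\<tau> \<le> v" "x \<tau> \<in> A" "\<And>s. 0 \<le> s \<Longrightarrow> s < \<tau> \<Longrightarrow> x s \<notin> A"
proof -
  define T where "T = {s. 0 \<le> s \<and> x s \<in> A}"
  define \<tau> where "\<tau> = Inf T"
  have T: "v \<in> T" "bdd_below T" using v by (auto simp: T_def intro!: bdd_belowI[of _ 0])
  have lower: "\<tau> \<le> s" if "s \<in> T" for s
    unfolding \<tau>_def using that T by (intro cInf_lower)
  have \<tau>0: "0 \<le> \<tau>"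
    unfolding \<tau>_def using T by (intro cInf_greatest) (auto simp: T_def)
  have "x \<tau> \<in> A"
  proof (rule ccontr)
    assume *: "x \<tau> \<notin> A"
    obtain c where c: "\<tau> < c" "\<And>y. \<tau> < y \<Longrightarrow> y < c \<Longrightarrow> x y = x \<tau>"
      using rc[OF \<tau>0] by (auto simp: eventually_at_right_field)
    have "c \<le> s" if "s \<in> T" for s
      using lower[OF that] that c(2)[of s] * by (force simp: T_def)
    then have "c \<le> \<tau>"
      unfolding \<tau>_def using T by (intro cInf_greatest) auto
    with c show False by simp
  qed
  then show ?thesis
    using that[of \<tau>] \<tau>0 lower T(1) by (force simp: T_def)
qed

lemma hitting_time_eqI:
  assumes "0 \<le> \<tau>" "X \<tau> \<omega> \<in> a" "\<And>s. 0 \<le> s \<Longrightarrow> s < \<tau> \<Longrightarrow> X s \<omega> \<notin> a"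
  shows "hitting_time X a \<omega> = ereal \<tau>"
  unfolding hitting_time_def using assms
  by (intro Inf_eqI) (auto simp: not_less[symmetric])

text \<open>This removes the extended-real infimum and leaves a condition on the path that can be
  compared with a grid. At the entrance time itself \<open>b\<close> is avoided because the state
  lies in \<open>a\<close>.\<close>

lemma hitting_event_iff:
  fixes X :: "real \<Rightarrow> 'w \<Rightarrow> 's"
  assumes rc: "\<And>t. 0 \<le> t \<Longrightarrow> \<forall>\<^sub>F s in at_right t. X s \<omega> = X t \<omega>"
    and ab: "a \<inter> b = {}"
  shows "(0 < hitting_time X a \<omega> \<and> hitting_time X a \<omega> \<le> ereal t \<and>
            (\<forall>v\<ge>0. ereal v \<le> hitting_time X a \<omega> \<longrightarrow> X v \<omega> \<notin> b))
    \<longleftrightarrow> (\<exists>\<tau>>0. \<tau> \<le> t \<and> X \<tau> \<omega> \<in> a \<and> (\<forall>v. 0 \<le> v \<and> v < \<tau> \<longrightarrow> X v \<omega> \<in> - (a \<union> b)))"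
    (is "?L \<longleftrightarrow> ?R")
proof
  assume L: ?L
  have "{v. 0 \<le> v \<and> X v \<omega> \<in> a} \<noteq> {}"
  proof
    \<comment> \<open>The infimum of the empty set is infinite, which contradicts the bound
      \<open>ereal t\<close>.\<close>
    assume "{v. 0 \<le> v \<and> X v \<omega> \<in> a} = {}"
    then have "hitting_time X a \<omega> = \<infinity>" by (simp only: hitting_time_def) (simp add: top_ereal_def)
    with L show False by simp
  qed
  then obtain v where v: "0 \<le> v" "X v \<omega> \<in> a" by blast
  obtain \<tau> where \<tau>: "0 \<le> \<tau>" "X \<tau> \<omega> \<in> a" "\<And>s. 0 \<le> s \<Longrightarrow> s < \<tau> \<Longrightarrow> X s \<omega> \<notin> a"
    using first_entrance[where x = "\<lambda>s. X s \<omega>", OF rc v] by metis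
  have eq: "hitting_time X a \<omega> = ereal \<tau>" using \<tau> by (rule hitting_time_eqI)
  show ?R using L \<tau> unfolding eq by (intro exI[of _ \<tau>]) auto
next
  assume ?R
  then obtain \<tau> where \<tau>: "0 < \<tau>" "\<tau> \<le> t" "X \<tau> \<omega> \<in> a" "\<And>v. 0 \<le> v \<Longrightarrow> v < \<tau> \<Longrightarrow> X v \<omega> \<in> - (a \<union> b)"
    by blast
  have eq: "hitting_time X a \<omega> = ereal \<tau>" using \<tau> by (intro hitting_time_eqI) auto
  have "X v \<omega> \<notin> b" if "0 \<le> v" "v \<le> \<tau>" for v
    using that \<tau>(3) \<tau>(4)[of v] ab by (cases "v = \<tau>") auto
  then show ?L unfolding eq using \<tau> by auto
qed

text \<open>Let \<tau> be the first exit time from \<open>S\<close>; the path keeps the value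
  \<open>x \<tau>\<close> up to some \<open>c > \<tau>\<close>. Once the step is shorter than
  \<open>c - \<tau>\<close>, the first grid time not before \<tau> falls below \<open>c\<close>, so
  the skeleton also leaves \<open>S\<close> through the state \<open>x \<tau>\<close>. Both sides
  then say that this state is in \<open>a\<close>.\<close>

lemma eventually_grid_entrance_iff:
  fixes x :: "real \<Rightarrow> 's"
  assumes rc: "\<And>t. 0 \<le> t \<Longrightarrow> \<forall>\<^sub>F s in at_right t. x s = x t"
    and t: "0 < t" and aS: "a \<inter> S = {}"
  shows "\<forall>\<^sub>F n in sequentially.
      (\<exists>k<n. (\<forall>l\<le>k. x (real l * (t / real n)) \<in> S) \<and> x (real (Suc k) * (t / real n)) \<in> a)
      \<longleftrightarrow> (\<exists>\<tau>>0. \<tau> \<le> t \<and> x \<tau> \<in> a \<and> (\<forall>v. 0 \<le> v \<and> v < \<tau> \<longrightarrow> x v \<in> S))"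
    (is "\<forall>\<^sub>F n in _. ?D n \<longleftrightarrow> ?E")
proof (cases "\<exists>v. 0 \<le> v \<and> v \<le> t \<and> x v \<notin> S")
  \<comment> \<open>Without an exit from \<open>S\<close> up to time \<open>t\<close> both sides
    fail: every grid time involved is at most \<open>t\<close>, and \<open>a\<close> is disjoint
    from \<open>S\<close>.\<close>
  case False
  have D: "\<not> ?D n" for n
  proof
    assume "?D n"
    then obtain k where k: "k < n" "x (real (Suc k) * (t / real n)) \<in> a" by blast
    then have "real (Suc k) * (t / real n) \<le> real n * (t / real n)"
      using t by (intro mult_right_mono) auto
    with k t have "real (Suc k) * (t / real n) \<le> t" by simp
    then have "x (real (Suc k) * (t / real n)) \<in> S" using False t by (simp del: of_nat_Suc)
    with k aS show False by blast
  qed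
  have E: "\<not> ?E" using False aS by (meson disjoint_iff less_imp_le)
  show ?thesis by (intro always_eventually allI) (simp only: D E)
next
  case True
  then obtain v where v: "0 \<le> v" "v \<le> t" "x v \<in> - S" by blast
  then obtain \<tau> where \<tau>: "0 \<le> \<tau>" "\<tau> \<le> t" "x \<tau> \<notin> S" "\<And>s. 0 \<le> s \<Longrightarrow> s < \<tau> \<Longrightarrow> x s \<in> S"
    using first_entrance[where x = x and A = "- S", OF rc v(1,3)] by (metis ComplD ComplI order_trans)
  show ?thesis
  proof (cases "\<tau> = 0")
    \<comment> \<open>Both sides require the state at time 0 to lie in \<open>S\<close>.\<close>
    case True
    with \<tau> have "x 0 \<notin> S" by simp
    then have E: "\<not> ?E" and D: "\<not> ?D n" for n by force+
    show ?thesis by (intro always_eventually allI) (simp only: D E)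
  next
    case False
    with \<tau> have \<tau>0: "0 < \<tau>" by simp
    have E: "?E \<longleftrightarrow> x \<tau> \<in> a"
    proof
      assume ?E
      then obtain \<sigma> where \<sigma>: "0 < \<sigma>" "x \<sigma> \<in> a" "\<And>v. 0 \<le> v \<Longrightarrow> v < \<sigma> \<Longrightarrow> x v \<in> S" by blast
      \<comment> \<open>Both are the first exit time from \<open>S\<close>, as \<open>a\<close> is
        disjoint from \<open>S\<close>.\<close>
      have "\<sigma> = \<tau>"
        using \<sigma> \<tau> aS by (metis disjoint_iff less_imp_le linorder_neqE)
      with \<sigma> show "x \<tau> \<in> a" by simp
    next
      assume "x \<tau> \<in> a"
      then show ?E using \<tau> \<tau>0 by blast
    qed
    obtain c where c: "\<tau> < c" "\<And>y. \<tau> < y \<Longrightarrow> y < c \<Longrightarrow> x y = x \<tau>"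
      using rc[OF \<tau>(1)] by (auto simp: eventually_at_right_field)
    have "(\<lambda>n. t / real n) \<longlonglongrightarrow> 0"
      by (rule lim_const_over_n)
    then have "\<forall>\<^sub>F n in sequentially. t / real n < c - \<tau>"
      using c by (intro order_tendstoD(2)) auto
    then show ?thesis
      using eventually_gt_at_top[of 0]
    proof eventually_elim
      case (elim n)
      define h where "h = t / real n"
      have h: "0 < h" "h < c - \<tau>" "real n * h = t" using elim t by (auto simp: h_def)
      obtain k where k: "real k * h < \<tau>" "\<tau> \<le> real (Suc k) * h"
      proof -
        \<comment> \<open>\<open>m\<close> is the index of the first grid time not before \<tau>. It
          is positive since \<tau> is, so \<open>k = m - 1\<close> is the last index with grid time
          strictly before \<tau>.\<close>
        define m where "m = nat \<lceil>\<tau> / h\<rceil>"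
        have m: "real m = of_int \<lceil>\<tau> / h\<rceil>" "0 < m" using \<tau>0 h by (auto simp: m_def)
        have "\<tau> / h \<le> real m" "real m < \<tau> / h + 1" unfolding m(1) by linarith+
        then have "\<tau> \<le> real m * h" "(real m - 1) * h < \<tau>" using h by (auto simp: field_simps)
        with m(2) show ?thesis
          by (intro that[of "m - 1"]) (auto simp: of_nat_diff)
      qed
      have "real k * h < real n * h" using k \<tau> h by simp
      then have kn: "k < n"
        using mult_less_cancel_right_pos[OF h(1), of "real k" "real n"] by (simp only: of_nat_less_iff)
      have "real (Suc k) * h < c" using k h by (simp add: algebra_simps)
      then have xk: "x (real (Suc k) * h) = x \<tau>"
        using k c(2)[of "real (Suc k) * h"] by (cases "\<tau> = real (Suc k) * h") auto
      have before: "x (real l * h) \<in> S" if "l \<le> k" for l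
      proof -
        have "real l * h \<le> real k * h" using that h by simp
        also note k(1)
        finally have "real l * h < \<tau>" .
        with h show ?thesis by (intro \<tau>(4)) auto
      qed
      have "?D n \<longleftrightarrow> x \<tau> \<in> a"
        unfolding h_def[symmetric]
      proof
        assume "\<exists>k<n. (\<forall>l\<le>k. x (real l * h) \<in> S) \<and> x (real (Suc k) * h) \<in> a"
        then obtain j where j: "\<And>l. l \<le> j \<Longrightarrow> x (real l * h) \<in> S" "x (real (Suc j) * h) \<in> a"
          by blast
        \<comment> \<open>The skeleton can hit only at step \<open>Suc k\<close>: earlier grid
          states lie in \<open>S\<close>, and a later hit would require \<open>x \<tau>\<close>, the
          state at step \<open>Suc k\<close>, to lie in \<open>S\<close>.\<close>
        have "\<not> Suc j \<le> k" using before j(2) aS by blast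
        moreover have "\<not> Suc k \<le> j" using j(1)[of "Suc k"] xk \<tau>(3) by auto
        ultimately have "j = k" by simp
        with j(2) xk show "x \<tau> \<in> a" by simp
      next
        assume "x \<tau> \<in> a"
        with kn before xk show "\<exists>k<n. (\<forall>l\<le>k. x (real l * h) \<in> S) \<and> x (real (Suc k) * h) \<in> a"
          by metis
      qed
      with E show ?case by simp
    qed
  qed
qed

section \<open>Calculus of the matrix exponential applied to a vector\<close>

text \<open>With an operator bound \<open>K\<close> the iterates grow at most like
  \<open>K ^ n\<close>, so the exponential series of \<open>K\<close> dominates.\<close>

lemma summable_iterate_over_fact:
  fixes f :: "'a::banach \<Rightarrow> 'a"
  assumes "bounded_linear f"
  shows "summable (\<lambda>n. (1 / fact n) *\<^sub>R (f ^^ n) x)"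
proof -
  obtain K where K: "0 < K" "\<And>y. norm (f y) \<le> norm y * K"
    using bounded_linear.pos_bounded[OF assms] by blast
  have "norm ((f ^^ n) x) \<le> K ^ n * norm x" for n
  proof (induction n)
    case (Suc n)
    have "norm ((f ^^ Suc n) x) \<le> norm ((f ^^ n) x) * K" using K by simp
    also have "\<dots> \<le> K ^ n * norm x * K" using Suc K by (intro mult_right_mono) auto
    finally show ?case by (simp add: mult_ac)
  qed simp
  then have bound: "norm ((1 / fact n) *\<^sub>R (f ^^ n) x) \<le> inverse (fact n) * K ^ n * norm x" for n
    by (simp add: field_simps)
  have "summable (\<lambda>n. inverse (fact n) * K ^ n * norm x)"
    by (rule summable_mult2[OF summable_exp])
  then show ?thesis by (rule summable_comparison_test') (rule bound)
qed

lemma bounded_linear_matrix_mult_right: "bounded_linear ((**) (A :: real^'n^'m))"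
  by (intro linear_conv_bounded_linear[THEN iffD1] linearI)
    (simp_all add: matrix_matrix_mult_def vec_eq_iff sum_distrib_left sum.distrib algebra_simps)

lemma bounded_linear_matrix_vector_left: "bounded_linear (\<lambda>A :: real^'n^'m. A *v x)"
  by (intro linear_conv_bounded_linear[THEN iffD1] linearI)
    (auto simp: matrix_vector_mult_add_rdistrib scaleR_matrix_vector_assoc)

lemma iterate_scaleR_matrix_vector:
  "((*v) (t *\<^sub>R A) ^^ n) x = t ^ n *\<^sub>R ((*v) (A :: real^'s^'s) ^^ n) x"
  by (induction n) (auto simp: scaleR_matrix_vector_assoc[symmetric] matrix_vector_mult_scaleR)

lemma matrix_exp_vector_sums:
  fixes A :: "real^'s^'s"
  shows "(\<lambda>n. (1 / fact n) *\<^sub>R ((*v) A ^^ n) x) sums (matrix_exp A *v x)"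
proof -
  have "((**) A ^^ n) (mat 1) *v x = ((*v) A ^^ n) x" for n
    by (induction n) (auto simp: matrix_vector_mul_assoc[symmetric])
  then show ?thesis
    using bounded_linear.sums[OF bounded_linear_matrix_vector_left
        summable_sums[OF summable_iterate_over_fact[OF bounded_linear_matrix_mult_right[of A], of "mat 1"]], of x]
    by (simp add: matrix_exp_def scaleR_matrix_vector_assoc[symmetric])
qed

text \<open>Each coordinate is an everywhere convergent real power series in \<open>t\<close>, which
  reduces differentiation and integration to scalar power series.\<close>

lemma matrix_exp_vector_nth_sums:
  fixes A :: "real^'s^'s"
  shows "(\<lambda>n. ((*v) A ^^ n) x $ j / fact n * t ^ n) sums (matrix_exp (t *\<^sub>R A) *v x) $ j"
  using bounded_linear.sums[OF bounded_linear_vec_nth matrix_exp_vector_sums[of "t *\<^sub>R A" x], of j]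
  by (simp add: iterate_scaleR_matrix_vector mult_ac)

lemma matrix_exp_vector_derivative:
  fixes A :: "real^'s^'s"
  shows "((\<lambda>t. (matrix_exp (t *\<^sub>R A) *v x) $ j) has_real_derivative
           (A *v (matrix_exp (t *\<^sub>R A) *v x)) $ j) (at t)"
proof -
  let ?c = "\<lambda>j n. ((*v) A ^^ n) x $ j / fact n"
  have eq: "(matrix_exp (t *\<^sub>R A) *v x) $ j = (\<Sum>n. ?c j n * t ^ n)" for t j
    using matrix_exp_vector_nth_sums by (rule sums_unique)
  have "(\<lambda>n. \<Sum>k\<in>UNIV. A $ j $ k * (?c k n * t ^ n)) sums (A *v (matrix_exp (t *\<^sub>R A) *v x)) $ j"
    unfolding matrix_vector_mult_def[of A "matrix_exp (t *\<^sub>R A) *v x"] vec_lambda_beta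
    by (intro sums_sum sums_mult matrix_exp_vector_nth_sums)
  \<comment> \<open>Termwise differentiation turns \<open>fact (Suc n)\<close> into
    \<open>fact n\<close> in the coefficient of index \<open>Suc n\<close>; the additional factor of
    the iterate there is the matrix \<open>A\<close> in front.\<close>
  also have "(\<lambda>n. \<Sum>k\<in>UNIV. A $ j $ k * (?c k n * t ^ n)) = (\<lambda>n. diffs (?c j) n * t ^ n)"
    by (simp add: diffs_def fun_eq_iff matrix_vector_mult_def[of A] sum_distrib_left sum_divide_distrib
        sum_distrib_right field_simps del: of_nat_Suc)
  finally have d: "(\<Sum>n. diffs (?c j) n * t ^ n) = (A *v (matrix_exp (t *\<^sub>R A) *v x)) $ j"
    by (simp add: sums_iff)
  show ?thesis
    using termdiffs_strong_converges_everywhere[of "?c j" t] matrix_exp_vector_nth_sums[of A x j]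
    unfolding eq d by (auto simp: sums_iff)
qed

lemma matrix_exp_zero_vector: "matrix_exp (0 *\<^sub>R (A :: real^'s^'s)) *v x = x"
  using sums_unique2[OF matrix_exp_vector_nth_sums[of A x _ 0] powser_sums_zero]
  by (simp add: vec_eq_iff)

text \<open>Integrate term by term: shift the coefficients and divide by the new index, which
  \<open>diffs\<close> undoes.\<close>

lemma powser_antiderivative:
  fixes c :: "nat \<Rightarrow> real"
  assumes c: "\<And>y. summable (\<lambda>n. c n * y ^ n)"
  obtains w where "w 0 = 0" "\<And>t. (w has_real_derivative (\<Sum>n. c n * t ^ n)) (at t)"
proof -
  define d where "d n = (case n of 0 \<Rightarrow> 0 | Suc m \<Rightarrow> c m / real (Suc m))" for n
  have "diffs d = c" by (simp add: diffs_def d_def fun_eq_iff)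
  moreover have "summable (\<lambda>n. d n * y ^ n)" for y
  proof (subst summable_Suc_iff[symmetric], rule summable_comparison_test'[where N = 0])
    \<comment> \<open>Convergence at the larger point \<open>\<bar>y\<bar> + 1\<close> makes the
      series absolutely convergent at \<open>y\<close>.\<close>
    show "summable (\<lambda>n. norm (c n * y ^ n) * \<bar>y\<bar>)"
      by (intro summable_mult2 powser_insidea[OF c[of "\<bar>y\<bar> + 1"]]) auto
    show "norm (d (Suc n) * y ^ Suc n) \<le> norm (c n * y ^ n) * \<bar>y\<bar>" for n
    proof -
      have "y / real (Suc n) \<le> y" if "0 \<le> y" for y :: real
        using divide_left_mono[of 1 "real (Suc n)" y] that by simp
      from this[of "\<bar>y\<bar> * (\<bar>c n\<bar> * \<bar>y\<bar> ^ n)"] show ?thesis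
        by (simp add: d_def abs_mult power_abs mult_ac del: of_nat_Suc)
    qed
  qed
  ultimately show ?thesis
    using that[of "\<lambda>x. \<Sum>n. d n * x ^ n"] termdiffs_strong_converges_everywhere[of d]
    by (simp add: d_def)
qed

text \<open>The third property is the equation \<open>y' = A y\<close> of the exponential integrated
  once. Since \<open>y = w'\<close>, it says \<open>w' = x + A w\<close>, the form in which
  \<open>w\<close> is compared with the semigroup.\<close>

lemma matrix_exp_antiderivative:
  fixes A :: "real^'s^'s"
  obtains w where "\<And>j. w j 0 = 0"
    and "\<And>j t. (w j has_real_derivative (matrix_exp (t *\<^sub>R A) *v x) $ j) (at t)"
    and "\<And>j t. (matrix_exp (t *\<^sub>R A) *v x) $ j = x $ j + (\<Sum>k\<in>UNIV. A $ j $ k * w k t)"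
proof -
  let ?g = "\<lambda>j t. (matrix_exp (t *\<^sub>R A) *v x) $ j"
  have "\<exists>w. w 0 = 0 \<and> (\<forall>t. (w has_real_derivative ?g j t) (at t))" for j
  proof -
    let ?c = "\<lambda>n. ((*v) A ^^ n) x $ j / fact n"
    obtain w where w: "w 0 = 0" "\<And>t. (w has_real_derivative (\<Sum>n. ?c n * t ^ n)) (at t)"
      using powser_antiderivative[of ?c] matrix_exp_vector_nth_sums[of A x j] by (auto simp: sums_iff)
    then show ?thesis
      using matrix_exp_vector_nth_sums[of A x j] by (auto simp: sums_iff)
  qed
  then obtain w where w0: "\<And>j. w j 0 = 0" and w: "\<And>j t. (w j has_real_derivative ?g j t) (at t)"
    by metis
  \<comment> \<open>both sides have the same derivative and agree at 0\<close>
  have "?g j t = x $ j + (\<Sum>k\<in>UNIV. A $ j $ k * w k t)" for j t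
  proof -
    let ?D = "\<lambda>t. ?g j t - (\<Sum>k\<in>UNIV. A $ j $ k * w k t)"
    have "(?D has_real_derivative
        (A *v (matrix_exp (t *\<^sub>R A) *v x)) $ j - (\<Sum>k\<in>UNIV. A $ j $ k * ?g k t)) (at t)" for t
      by (intro DERIV_diff DERIV_sum DERIV_cmult w matrix_exp_vector_derivative)
    then have "?D t = ?D 0"
      by (intro DERIV_isconst_all) (simp add: matrix_vector_mult_def[of A])
    then show ?thesis by (simp only: w0 matrix_exp_zero_vector) simp
  qed
  with w0 w that show ?thesis by blast
qed

section \<open>One-step error of the semigroup against the candidate \<open>w\<close>\<close>

text \<open>Bundling the functions into one vector-valued path gives a bound that is uniform in
  \<open>j\<close>.\<close>

lemma compact_bound_family:
  fixes f :: "'s::finite \<Rightarrow> real \<Rightarrow> real"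
  assumes "\<And>j. continuous_on {0..t} (f j)"
  obtains B where "0 \<le> B" "\<And>j s. 0 \<le> s \<Longrightarrow> s \<le> t \<Longrightarrow> \<bar>f j s\<bar> \<le> B"
proof -
  have "compact ((\<lambda>s. \<chi> j. f j s) ` {0..t})"
    using assms by (intro compact_continuous_image continuous_on_vec_lambda) auto
  then obtain B where B: "0 < B" "\<forall>y\<in>(\<lambda>s. \<chi> j. f j s) ` {0..t}. norm y \<le> B"
    using bounded_pos[THEN iffD1, OF compact_imp_bounded] by blast
  show ?thesis
  proof (rule that[of B])
    fix j s
    assume "0 \<le> s" "s \<le> t"
    then have "norm (\<chi> j. f j s) \<le> B" using B(2) by simp
    then show "\<bar>f j s\<bar> \<le> B"
      using component_le_norm_cart[of "\<chi> j. f j s" j] by simp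
  qed (use B in simp)
qed

text \<open>To first order \<open>p h\<close> is \<open>mat 1 + h *\<^sub>R \<Lambda>\<close>, so
  the one-step average is \<open>w m s + h * g m s\<close> up to \<open>o(h)\<close>, and so is
  \<open>w m (s + h)\<close>. The bound is uniform in \<open>s\<close> and \<open>m\<close>, so the
  errors of many steps can be added.\<close>

lemma semigroup_local_error:
  fixes p :: "real \<Rightarrow> real^'s^'s" and w g :: "'s \<Rightarrow> real \<Rightarrow> real"
  assumes p: "(p has_vector_derivative \<Lambda>) (at 0 within {0..})" and p0: "p 0 = mat 1"
    and aS: "a \<inter> S = {}"
    and w: "\<And>j s. (w j has_real_derivative g j s) (at s)"
    and g_cont: "\<And>j. continuous_on UNIV (g j)"
    and g: "\<And>j s. j \<in> S \<Longrightarrow> g j s = (\<Sum>k\<in>a. \<Lambda> $ j $ k) + (\<Sum>k\<in>S. \<Lambda> $ j $ k * w k s)"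
  obtains \<epsilon> where "(\<epsilon> \<longlongrightarrow> 0) (at_right 0)" "\<And>h. 0 < h \<Longrightarrow> 0 \<le> \<epsilon> h"
    "\<And>h s m. 0 < h \<Longrightarrow> 0 \<le> s \<Longrightarrow> s + h \<le> t \<Longrightarrow> m \<in> S \<Longrightarrow>
        \<bar>(\<Sum>j\<in>a. p h $ m $ j) + (\<Sum>j\<in>S. p h $ m $ j * w j s) - w m (s + h)\<bar> \<le> h * \<epsilon> h"
proof -
  \<comment> \<open>Entrywise error of the difference quotient of \<open>p\<close> at 0.\<close>
  define e where "e m j h = (p h $ m $ j - mat 1 $ m $ j) / h - \<Lambda> $ m $ j" for m j h
  have e: "((\<lambda>h. e m j h) \<longlongrightarrow> 0) (at_right 0)" for m j
  proof -
    have "((\<lambda>h. p h $ m $ j) has_vector_derivative \<Lambda> $ m $ j) (at 0 within {0..})"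
      by (intro bounded_linear.has_vector_derivative[OF bounded_linear_vec_nth] p)
    then have "((\<lambda>h. (p h $ m $ j - p 0 $ m $ j) / h) \<longlongrightarrow> \<Lambda> $ m $ j) (at_right 0)"
      by (simp add: has_real_derivative_iff_has_vector_derivative[symmetric] has_field_derivative_iff
          at_within_Ici_at_right)
    then show ?thesis
      unfolding e_def p0 by (rule LIM_zero)
  qed
  have p_eq: "p h $ m $ j = mat 1 $ m $ j + h * (\<Lambda> $ m $ j + e m j h)" if "0 < h" for m j h
    using that by (simp add: e_def field_simps)
  obtain W where W: "0 \<le> W" "\<And>j s. 0 \<le> s \<Longrightarrow> s \<le> t \<Longrightarrow> \<bar>w j s\<bar> \<le> W"
  proof (rule compact_bound_family[of t w])
    show "continuous_on {0..t} (w j)" for j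
      using w[of j] by (intro DERIV_continuous_on[of _ _ "g j"]) (auto intro: has_field_derivative_at_within)
  qed auto
  obtain G where G: "0 \<le> G" "\<And>j s. 0 \<le> s \<Longrightarrow> s \<le> t \<Longrightarrow> \<bar>g j s\<bar> \<le> G"
    by (rule compact_bound_family[of t g]) (use g_cont continuous_on_subset in blast)+
  define C where "C = (\<Sum>m\<in>UNIV. \<Sum>k\<in>UNIV. \<bar>\<Lambda> $ m $ k\<bar>) * G"
  \<comment> \<open>The first term covers the errors \<open>e\<close>, which carry weight 1 on
    \<open>a\<close> and at most \<open>W\<close> on \<open>S\<close>; the second covers the
    variation of \<open>g\<close> within one step. Summing over all entries makes both independent
    of \<open>m\<close>.\<close>
  define \<epsilon> where "\<epsilon> h = (\<Sum>m\<in>UNIV. \<Sum>j\<in>UNIV. \<bar>e m j h\<bar>) * (1 + W) + C * h" for h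
  have row: "(\<Sum>j\<in>UNIV. F m j) \<le> (\<Sum>m\<in>UNIV. \<Sum>j\<in>UNIV. F m j)"
    if "\<And>m j. 0 \<le> F m j" for F :: "'s \<Rightarrow> 's \<Rightarrow> real" and m
    using that by (intro member_le_sum) (auto intro: sum_nonneg)
  show ?thesis
  proof (rule that[of \<epsilon>])
    have "((\<lambda>h. (\<Sum>m\<in>UNIV. \<Sum>j\<in>UNIV. \<bar>e m j h\<bar>) * (1 + W) + C * h)
        \<longlongrightarrow> (\<Sum>m\<in>(UNIV::'s set). \<Sum>j\<in>(UNIV::'s set). \<bar>0\<bar>) * (1 + W) + C * 0) (at_right 0)"
      by (intro tendsto_intros e)
    then show "(\<epsilon> \<longlongrightarrow> 0) (at_right 0)" by (simp add: \<epsilon>_def[abs_def])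
    show "0 \<le> \<epsilon> h" if "0 < h" for h
      unfolding \<epsilon>_def C_def using W G that by (intro add_nonneg_nonneg mult_nonneg_nonneg sum_nonneg) auto
  next
    fix h s :: real and m
    assume h: "0 < h" and s: "0 \<le> s" "s + h \<le> t" and m: "m \<in> S"
    obtain \<xi> where \<xi>: "s < \<xi>" "\<xi> < s + h" "w m (s + h) - w m s = h * g m \<xi>"
      using MVT2[of s "s + h" "w m" "g m"] w h by auto
    have inc: "\<bar>w k \<xi> - w k s\<bar> \<le> G * h" for k
    proof -
      obtain \<eta> where \<eta>: "s < \<eta>" "\<eta> < \<xi>" "w k \<xi> - w k s = (\<xi> - s) * g k \<eta>"
        using MVT2[of s \<xi> "w k" "g k"] w \<xi> by auto
      have "\<bar>w k \<xi> - w k s\<bar> \<le> h * G"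
        unfolding \<eta>(3) abs_mult using G(2)[of \<eta> k] \<eta> \<xi> s h by (intro mult_mono) auto
      then show ?thesis by (simp add: mult.commute)
    qed
    \<comment> \<open>In the linear relation for \<open>g\<close> only the \<open>w\<close> part
      varies, and \<open>w\<close> is Lipschitz with constant \<open>G\<close>.\<close>
    have g_diff: "\<bar>g m s - g m \<xi>\<bar> \<le> C * h"
    proof -
      have "\<bar>g m s - g m \<xi>\<bar> = \<bar>\<Sum>k\<in>S. \<Lambda> $ m $ k * (w k \<xi> - w k s)\<bar>"
        unfolding g[OF m] abs_minus_commute[of "_ + (\<Sum>k\<in>S. _ k * w k s)"]
        by (simp add: sum_subtractf[symmetric] algebra_simps)
      also have "\<dots> \<le> (\<Sum>k\<in>S. \<bar>\<Lambda> $ m $ k\<bar> * (G * h))"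
        by (intro order_trans[OF sum_abs] sum_mono) (auto simp: abs_mult intro!: mult_left_mono inc)
      also have "\<dots> \<le> (\<Sum>k\<in>UNIV. \<bar>\<Lambda> $ m $ k\<bar> * (G * h))"
        using G h by (intro sum_mono2) auto
      also have "\<dots> = (\<Sum>k\<in>UNIV. \<bar>\<Lambda> $ m $ k\<bar>) * (G * h)" by (simp add: sum_distrib_right)
      also have "\<dots> \<le> (\<Sum>m\<in>UNIV. \<Sum>k\<in>UNIV. \<bar>\<Lambda> $ m $ k\<bar>) * (G * h)"
        using G h row[of "\<lambda>m k. \<bar>\<Lambda> $ m $ k\<bar>" m] by (intro mult_right_mono) auto
      finally show ?thesis by (simp add: C_def mult_ac)
    qed
    let ?R = "(\<Sum>j\<in>a. e m j h) + (\<Sum>j\<in>S. e m j h * w j s)"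
    have "\<bar>?R\<bar> \<le> (\<Sum>j\<in>a. \<bar>e m j h\<bar>) + (\<Sum>j\<in>S. \<bar>e m j h\<bar> * W)"
      using W s h
      by (intro order_trans[OF abs_triangle_ineq] add_mono sum_abs order_trans[OF sum_abs] sum_mono)
        (auto simp: abs_mult intro!: mult_left_mono)
    also have "\<dots> \<le> (\<Sum>j\<in>UNIV. \<bar>e m j h\<bar>) + (\<Sum>j\<in>UNIV. \<bar>e m j h\<bar> * W)"
      using W by (intro add_mono sum_mono2) auto
    also have "\<dots> = (\<Sum>j\<in>UNIV. \<bar>e m j h\<bar>) * (1 + W)"
      by (simp add: sum_distrib_right distrib_left)
    also have "\<dots> \<le> (\<Sum>m\<in>UNIV. \<Sum>j\<in>UNIV. \<bar>e m j h\<bar>) * (1 + W)"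
      using W row[of "\<lambda>m j. \<bar>e m j h\<bar>" m] by (intro mult_right_mono) auto
    finally have R: "\<bar>?R\<bar> \<le> \<dots>" .
    \<comment> \<open>As \<open>m\<close> is in \<open>S\<close> and hence not in \<open>a\<close>,
      the identity matrix contributes nothing here; in the sum over \<open>S\<close> below it
      contributes \<open>w m s\<close>.\<close>
    have "(\<Sum>j\<in>a. p h $ m $ j) = h * (\<Sum>j\<in>a. \<Lambda> $ m $ j) + h * (\<Sum>j\<in>a. e m j h)"
    proof -
      have "(\<Sum>j\<in>a. p h $ m $ j) = (\<Sum>j\<in>a. h * (\<Lambda> $ m $ j + e m j h))"
        using m aS by (intro sum.cong refl) (auto simp: p_eq[OF h] mat_def)
      then show ?thesis by (simp add: sum.distrib sum_distrib_left algebra_simps)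
    qed
    moreover have "(\<Sum>j\<in>S. p h $ m $ j * w j s)
        = w m s + h * (\<Sum>j\<in>S. \<Lambda> $ m $ j * w j s) + h * (\<Sum>j\<in>S. e m j h * w j s)"
    proof -
      have "(\<Sum>j\<in>S. p h $ m $ j * w j s)
          = (\<Sum>j\<in>S. (if m = j then w j s else 0) + h * (\<Lambda> $ m $ j * w j s) + h * (e m j h * w j s))"
        by (intro sum.cong refl) (auto simp: p_eq[OF h] mat_def algebra_simps)
      then show ?thesis using m by (simp add: sum.distrib sum_distrib_left)
    qed
    ultimately have "(\<Sum>j\<in>a. p h $ m $ j) + (\<Sum>j\<in>S. p h $ m $ j * w j s) - w m (s + h)
        = h * (?R + (g m s - g m \<xi>))"
      using \<xi>(3) by (simp add: g[OF m, of s] algebra_simps)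
    also have "\<bar>\<dots>\<bar> \<le> h * \<epsilon> h"
      unfolding abs_mult \<epsilon>_def using h R g_diff by (intro mult_mono) auto
    finally show "\<bar>(\<Sum>j\<in>a. p h $ m $ j) + (\<Sum>j\<in>S. p h $ m $ j * w j s) - w m (s + h)\<bar> \<le> h * \<epsilon> h" .
  qed
qed

section \<open>The mixed law and the passage from the skeleton to continuous time\<close>

text \<open>\<open>measure_of\<close> returns the weighted sum once that set function is shown to be
  countably additive, by exchanging the finite sum over \<open>i\<close> with the series.\<close>

lemma measure_mixture:
  fixes M :: "'w measure" and P :: "'s::finite \<Rightarrow> 'w measure"
  assumes "\<And>i. prob_space (P i)" and sets_P: "\<And>i. sets (P i) = sets M"
    and \<alpha>: "\<And>i. 0 \<le> \<alpha> $ i" and A: "A \<in> sets M"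
  shows "measure (mixture M P \<alpha>) A = (\<Sum>i\<in>UNIV. \<alpha> $ i * measure (P i) A)"
proof -
  interpret P: prob_space "P i" for i by fact
  let ?\<mu> = "\<lambda>A. \<Sum>i\<in>UNIV. ennreal (\<alpha> $ i) * emeasure (P i) A"
  have "emeasure (mixture M P \<alpha>) A = ?\<mu> A"
    unfolding mixture_def
  proof (rule emeasure_measure_of_sigma)
    show "countably_additive (sets M) ?\<mu>"
    proof (rule countably_additiveI)
      fix F :: "nat \<Rightarrow> 'w set"
      assume F: "range F \<subseteq> sets M" "disjoint_family F"
      have "(\<Sum>n. ?\<mu> (F n)) = (\<Sum>i\<in>UNIV. \<Sum>n. ennreal (\<alpha> $ i) * emeasure (P i) (F n))"
        by (intro suminf_sum) auto
      also have "\<dots> = ?\<mu> (\<Union>n. F n)"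
        using F by (simp add: suminf_emeasure sets_P)
      finally show "(\<Sum>n. ?\<mu> (F n)) = ?\<mu> (\<Union>n. F n)" .
    qed
  qed (use A sets.sigma_algebra_axioms in \<open>auto simp: positive_def\<close>)
  also have "\<dots> = ennreal (\<Sum>i\<in>UNIV. \<alpha> $ i * measure (P i) A)"
    using \<alpha> by (simp add: P.emeasure_eq_measure ennreal_mult'[symmetric])
  finally show ?thesis
    using \<alpha> by (simp add: measure_def sum_nonneg)
qed

text \<open>For each path the skeleton event eventually agrees with \<open>E\<close>. Pointwise
  convergence of the indicators makes \<open>E\<close> measurable, although it involves uncountably
  many times, and dominated convergence gives the limit of the probabilities.\<close>

lemma grid_hit_measure_tendsto:
  assumes "markov_process M P X \<Lambda>" and ab: "a \<inter> b = {}" and S: "S = - (a \<union> b)" and t: "0 < t"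
  defines "E \<equiv> {\<omega> \<in> space M. 0 < hitting_time X a \<omega> \<and> hitting_time X a \<omega> \<le> ereal t \<and>
                (\<forall>v\<ge>0. ereal v \<le> hitting_time X a \<omega> \<longrightarrow> X v \<omega> \<notin> b)}"
  shows sets_hitting_event: "E \<in> sets M"
    and "(\<lambda>n. measure (P i) (grid_hit (P i) X S a (t / real n) n)) \<longlonglongrightarrow> measure (P i) E"
proof -
  interpret markov_process M P X \<Lambda> by fact
  interpret N: prob_space "P i" by (rule prob_space_P)
  have sp: "space (P i) = space M" using sets_P by (rule sets_eq_imp_space_eq)
  have X: "X u \<in> measurable (P i) (count_space UNIV)" if "0 \<le> u" for u
    using measurable_X[OF that] by (simp add: measurable_cong_sets[OF sets_P refl])
  let ?F = "\<lambda>n. grid_hit (P i) X S a (t / real n) n"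
  have F: "?F n \<in> sets (P i)" for n
    using t by (intro sets_grid_hit X) auto
  have lim: "(\<lambda>n. indicator (?F n) \<omega> :: real) \<longlonglongrightarrow> indicator E \<omega>" if "\<omega> \<in> space (P i)" for \<omega>
  proof -
    have rc: "\<forall>\<^sub>F s in at_right t. X s \<omega> = X t \<omega>" if "0 \<le> t" for t
      using paths[of \<omega>] \<open>\<omega> \<in> space (P i)\<close> that by (simp add: rc_piecewise_constant_def sp)
    have aS: "a \<inter> S = {}" unfolding S by blast
    have "\<omega> \<in> E \<longleftrightarrow> (\<exists>\<tau>>0. \<tau> \<le> t \<and> X \<tau> \<omega> \<in> a \<and> (\<forall>v. 0 \<le> v \<and> v < \<tau> \<longrightarrow> X v \<omega> \<in> S))"
      using hitting_event_iff[of X \<omega> a b t, OF rc ab] that by (simp add: E_def sp S)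
    moreover have "\<forall>\<^sub>F n in sequentially.
        (\<exists>k<n. (\<forall>l\<le>k. X (real l * (t / real n)) \<omega> \<in> S) \<and> X (real (Suc k) * (t / real n)) \<omega> \<in> a)
        \<longleftrightarrow> (\<exists>\<tau>>0. \<tau> \<le> t \<and> X \<tau> \<omega> \<in> a \<and> (\<forall>v. 0 \<le> v \<and> v < \<tau> \<longrightarrow> X v \<omega> \<in> S))"
      by (rule eventually_grid_entrance_iff) (fact rc t aS)+
    ultimately have "\<forall>\<^sub>F n in sequentially. \<omega> \<in> ?F n \<longleftrightarrow> \<omega> \<in> E"
      using that by (simp only: grid_hit_def mem_Collect_eq simp_thms)
    then show ?thesis
      by (intro tendsto_eventually) (auto elim!: eventually_mono simp: indicator_def)
  qed
  have EN: "E \<in> sets (P i)"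
  proof -
    have "(indicator E :: _ \<Rightarrow> real) \<in> borel_measurable (P i)"
      by (rule borel_measurable_LIMSEQ_real[OF lim borel_measurable_indicator[OF F]])
    moreover have "E \<subseteq> space (P i)" by (auto simp: E_def sp)
    ultimately show ?thesis by (simp add: borel_measurable_indicator_iff Int_absorb2)
  qed
  then show "E \<in> sets M" by (simp add: sets_P)
  have "(\<lambda>n. \<integral>\<omega>. indicator (?F n) \<omega> \<partial>P i) \<longlonglongrightarrow> (\<integral>\<omega>. indicator E \<omega> \<partial>P i :: real)"
  proof (rule integral_dominated_convergence[where w = "\<lambda>_. 1"])
    show "AE \<omega> in P i. (\<lambda>n. indicator (?F n) \<omega> :: real) \<longlonglongrightarrow> indicator E \<omega>"
      using lim by (rule AE_I2)
    show "AE \<omega> in P i. norm (indicator (?F n) \<omega> :: real) \<le> 1" for n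
      by (rule AE_I2) (simp add: indicator_def)
  qed (simp_all add: EN F borel_measurable_indicator)
  then show "(\<lambda>n. measure (P i) (?F n)) \<longlonglongrightarrow> measure (P i) E"
    unfolding Bochner_Integration.integral_indicator sets.Int_space_eq2[OF EN] sets.Int_space_eq2[OF F] .
qed

text \<open>The skeleton probabilities have two limits: the probability of the event, and
  \<open>w i t\<close>, because \<open>n\<close> local errors \<open>h * \<epsilon> h\<close> with
  \<open>n h = t\<close> add up to \<open>t * \<epsilon> h\<close>, which tends to 0.\<close>

lemma measure_hitting_event:
  fixes X :: "real \<Rightarrow> 'w \<Rightarrow> 's::finite"
  assumes mp: "markov_process M P X \<Lambda>" and ab: "a \<inter> b = {}" and S: "S = - (a \<union> b)"
    and t: "0 < t" and i: "i \<in> S"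
    and w0: "\<And>j. w j 0 = 0"
    and w: "\<And>j s. (w j has_real_derivative g j s) (at s)"
    and g_cont: "\<And>j. continuous_on UNIV (g j)"
    and g: "\<And>j s. j \<in> S \<Longrightarrow> g j s = (\<Sum>k\<in>a. \<Lambda> $ j $ k) + (\<Sum>k\<in>S. \<Lambda> $ j $ k * w k s)"
  shows "measure (P i) {\<omega> \<in> space M. 0 < hitting_time X a \<omega> \<and> hitting_time X a \<omega> \<le> ereal t \<and>
                (\<forall>v\<ge>0. ereal v \<le> hitting_time X a \<omega> \<longrightarrow> X v \<omega> \<notin> b)} = w i t"
    (is "measure _ ?E = _")
proof -
  interpret markov_process M P X \<Lambda> by (rule mp)
  interpret N: prob_space "P i" by (rule prob_space_P)
  have sp: "space (P i) = space M" using sets_P by (rule sets_eq_imp_space_eq)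
  have X: "X u \<in> measurable (P i) (count_space UNIV)" if "0 \<le> u" for u
    using measurable_X[OF that] by (simp add: measurable_cong_sets[OF sets_P refl])
  have aS: "a \<inter> S = {}" unfolding S by blast
  obtain p where p: "transition_semigroup p" "(p has_vector_derivative \<Lambda>) (at 0 within {0..})"
    and mk: "\<And>t h k. 0 \<le> t \<Longrightarrow> 0 \<le> h \<Longrightarrow> AE \<omega> in P i. real_cond_exp (P i) (past (P i) X t)
          (indicator {\<omega> \<in> space (P i). X (t + h) \<omega> = k}) \<omega> = p h $ X t \<omega> $ k"
    using markov[of i] unfolding homogeneous_markov_def by blast
  have p0: "p 0 = mat 1" using p(1) by (simp add: transition_semigroup_def)
  obtain \<epsilon> where \<epsilon>: "(\<epsilon> \<longlongrightarrow> 0) (at_right 0)" "\<And>h. 0 < h \<Longrightarrow> 0 \<le> \<epsilon> h"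
    and loc: "\<And>h s m. 0 < h \<Longrightarrow> 0 \<le> s \<Longrightarrow> s + h \<le> t \<Longrightarrow> m \<in> S \<Longrightarrow>
        \<bar>(\<Sum>j\<in>a. p h $ m $ j) + (\<Sum>j\<in>S. p h $ m $ j * w j s) - w m (s + h)\<bar> \<le> h * \<epsilon> h"
    using semigroup_local_error[where t = t, OF p(2) p0 aS w g_cont g] by blast
  \<comment> \<open>Under \<open>P i\<close> the state \<open>i\<close>, an element of
    \<open>S\<close>, carries all the initial mass.\<close>
  have start0: "(\<Sum>m\<in>S. measure (P i) (grid_stay (P i) X S h 0 m) * c m) = c i" for h and c :: "'s \<Rightarrow> real"
  proof -
    have X0: "{\<omega> \<in> space (P i). X 0 \<omega> \<in> {j}} \<in> sets (P i)" for j
      using X by (intro sets_X_in) simp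
    have eq: "grid_stay (P i) X S h 0 m = {\<omega> \<in> space (P i). X 0 \<omega> \<in> {m}}" if "m \<in> S" for m
      using that by (auto simp: grid_stay_def)
    have 1: "measure (P i) {\<omega> \<in> space (P i). X 0 \<omega> \<in> {i}} = 1"
      using start[of i] by (simp add: sp)
    have "measure (P i) {\<omega> \<in> space (P i). X 0 \<omega> \<in> {m}} = 0" if "m \<noteq> i" for m
    proof -
      have "measure (P i) {\<omega> \<in> space (P i). X 0 \<omega> \<in> {m}} + 1
          = measure (P i) ({\<omega> \<in> space (P i). X 0 \<omega> \<in> {m}} \<union> {\<omega> \<in> space (P i). X 0 \<omega> \<in> {i}})"
        unfolding 1[symmetric] using that
        by (intro N.finite_measure_Union[symmetric] X0) auto
      also have "\<dots> \<le> 1" by (rule N.prob_le_1)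
      finally show ?thesis using measure_nonneg[of "P i"] by (smt (verit))
    qed
    with 1 have "(\<Sum>m\<in>S. measure (P i) (grid_stay (P i) X S h 0 m) * c m)
        = (\<Sum>m\<in>S. if m = i then c m else 0)"
      by (intro sum.cong refl) (auto simp: eq)
    then show ?thesis using i by simp
  qed
  let ?F = "\<lambda>n. grid_hit (P i) X S a (t / real n) n"
  have bound: "\<bar>measure (P i) (?F n) - w i t\<bar> \<le> t * \<epsilon> (t / real n)" if n: "0 < n" for n
  proof -
    define h where "h = t / real n"
    have h: "0 < h" "real n * h = t" using n t by (auto simp: h_def)
    have "\<bar>measure (P i) (grid_hit (P i) X S a h n)
        - (\<Sum>m\<in>S. measure (P i) (grid_stay (P i) X S h 0 m) * w m (real n * h))\<bar> \<le> real n * (h * \<epsilon> h)"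
    \<comment> \<open>\<open>W k\<close> is \<open>w\<close> at \<open>k h\<close>, the time left
      when \<open>k\<close> steps remain.\<close>
    proof (rule grid_hit_potential[where p = "p h" and W = "\<lambda>k m. w m (real k * h)"])
      fix k m
      assume k: "k < n" and m: "m \<in> S"
      have "real (Suc k) * h \<le> real n * h" using k h by (intro mult_right_mono) auto
      then have "real k * h + h \<le> t" unfolding h(2) by (simp add: algebra_simps)
      then show "\<bar>(\<Sum>j\<in>a. p h $ m $ j) + (\<Sum>j\<in>S. p h $ m $ j * w j (real k * h))
          - w m (real (Suc k) * h)\<bar> \<le> h * \<epsilon> h"
        using loc[of h "real k * h" m] h m by (simp add: algebra_simps)
    qed (use X mk h aS \<epsilon> w0 in \<open>auto intro: prob_space_P\<close>)
    then show ?thesis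
      unfolding start0 by (simp only: h(2) mult.assoc[symmetric] h_def[symmetric])
  qed
  have "((\<lambda>n. t / real n) \<longlongrightarrow> 0) sequentially" by (rule lim_const_over_n)
  \<comment> \<open>\<epsilon> is controlled only on the right of 0, so the positivity of
    \<open>t / n\<close> matters.\<close>
  then have "filterlim (\<lambda>n. t / real n) (at_right 0) sequentially"
    using t by (auto simp: filterlim_at intro: eventually_mono[OF eventually_gt_at_top[of 0]])
  then have "(\<lambda>n. t * \<epsilon> (t / real n)) \<longlonglongrightarrow> t * 0"
    by (intro tendsto_mult tendsto_const filterlim_compose[OF \<epsilon>(1)])
  then have "(\<lambda>n. t * \<epsilon> (t / real n)) \<longlonglongrightarrow> 0" by (simp only: mult_zero_right)
  moreover have "\<forall>\<^sub>F n in sequentially. norm (measure (P i) (?F n) - w i t) \<le> t * \<epsilon> (t / real n)"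
    unfolding real_norm_def using eventually_gt_at_top[of 0] by eventually_elim (rule bound)
  ultimately have "(\<lambda>n. measure (P i) (?F n) - w i t) \<longlonglongrightarrow> 0"
    by (rule Lim_null_comparison[rotated])
  then have "(\<lambda>n. measure (P i) (?F n)) \<longlonglongrightarrow> w i t" by (rule LIM_zero_cancel)
  moreover have "(\<lambda>n. measure (P i) (?F n)) \<longlonglongrightarrow> measure (P i) ?E"
    by (rule grid_hit_measure_tendsto[OF mp ab S t])
  ultimately show ?thesis by (rule LIMSEQ_unique[symmetric])
qed

theorem theorem3p1:
  fixes M :: "'w measure"
    and P :: "'s::finite \<Rightarrow> 'w measure"
    and X :: "real \<Rightarrow> 'w \<Rightarrow> 's"
    and \<Lambda> :: "real^'s^'s"
    and \<alpha> :: "real^'s"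
    and a b d :: "'s set"
    and u :: real
  assumes "markov_process M P X \<Lambda>"
    and "a \<inter> b = {}"
    and "d = a \<union> b"
    and "prob_vector \<alpha>"
    and "\<forall>i\<in>d. \<alpha> $ i = 0"
    and "u > 0"
  shows "((\<lambda>t. measure (mixture M P \<alpha>)
             {\<omega> \<in> space M. 0 < hitting_time X a \<omega> \<and> hitting_time X a \<omega> \<le> ereal t \<and>
                (\<forall>v\<ge>0. ereal v \<le> hitting_time X a \<omega> \<longrightarrow> X v \<omega> \<notin> b)})
          has_real_derivative
            (\<alpha> v* matrix_exp (u *\<^sub>R submat \<Lambda> (- d) (- d)) v* submat \<Lambda> (- d) a) \<bullet> 1)
         (at u)"
    (is "((\<lambda>t. measure _ (?E t)) has_real_derivative _) _")
proof -
  interpret markov_process M P X \<Lambda> by fact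
  define S where "S = - d"
  have S: "S = - (a \<union> b)" using assms(3) by (simp add: S_def)
  \<comment> \<open>\<open>?x\<close> lists the total rates from the states of \<open>S\<close> into
    \<open>a\<close>.\<close>
  let ?A = "submat \<Lambda> S S" and ?x = "submat \<Lambda> S a *v 1"
  let ?g = "\<lambda>j t. (matrix_exp (t *\<^sub>R ?A) *v ?x) $ j"
  obtain w where w0: "\<And>j. w j 0 = 0" and w: "\<And>j t. (w j has_real_derivative ?g j t) (at t)"
    and g: "\<And>j t. ?g j t = ?x $ j + (\<Sum>k\<in>UNIV. ?A $ j $ k * w k t)"
  proof (rule matrix_exp_antiderivative[of ?A ?x], goal_cases)
    case (1 w)
    show thesis by (rule 1(1)[OF 1(2-4)])
  qed
  have g_cont: "continuous_on UNIV (?g j)" for j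
    by (rule DERIV_continuous_on[OF has_field_derivative_at_within[OF matrix_exp_vector_derivative]])
  have gS: "?g j s = (\<Sum>k\<in>a. \<Lambda> $ j $ k) + (\<Sum>k\<in>S. \<Lambda> $ j $ k * w k s)" if "j \<in> S" for j s
  proof -
    have "?x $ j = (\<Sum>k\<in>UNIV. if k \<in> a then \<Lambda> $ j $ k else 0)"
      using that by (simp add: matrix_vector_mult_def submat_def)
    moreover have "(\<Sum>k\<in>UNIV. ?A $ j $ k * w k s) = (\<Sum>k\<in>UNIV. if k \<in> S then \<Lambda> $ j $ k * w k s else 0)"
      using that by (intro sum.cong) (auto simp: submat_def)
    ultimately show ?thesis unfolding g by (simp add: sum.If_cases)
  qed
  have \<alpha>: "0 \<le> \<alpha> $ i" "i \<notin> S \<Longrightarrow> \<alpha> $ i = 0" for i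
    using assms(4,5) by (auto simp: prob_vector_def S_def)
  have eq: "measure (mixture M P \<alpha>) (?E t) = (\<Sum>i\<in>UNIV. \<alpha> $ i * w i t)" if "0 < t" for t
  proof -
    have "?E t \<in> sets M"
      by (rule sets_hitting_event[OF assms(1,2) S that])
    then have "measure (mixture M P \<alpha>) (?E t) = (\<Sum>i\<in>UNIV. \<alpha> $ i * measure (P i) (?E t))"
      by (intro measure_mixture prob_space_P sets_P \<alpha>)
    also have "\<dots> = (\<Sum>i\<in>UNIV. \<alpha> $ i * w i t)"
    proof (rule sum.cong[OF refl])
      \<comment> \<open>Outside \<open>S\<close> the weight \<open>\<alpha> $ i\<close> is 0; inside
        \<open>S\<close> the probability is \<open>w i t\<close>.\<close>
      show "\<alpha> $ i * measure (P i) (?E t) = \<alpha> $ i * w i t" for i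
        using measure_hitting_event[OF assms(1,2) S that _ w0 w g_cont gS, of i] \<alpha>(2)[of i]
        by (cases "i \<in> S") auto
    qed
    finally show ?thesis .
  qed
  have "((\<lambda>t. \<Sum>i\<in>UNIV. \<alpha> $ i * w i t) has_real_derivative (\<Sum>i\<in>UNIV. \<alpha> $ i * ?g i u)) (at u)"
    by (intro DERIV_sum DERIV_cmult w)
  \<comment> \<open>Each matrix moves across the inner product from the row vector to the vector of
    ones.\<close>
  also have "(\<Sum>i\<in>UNIV. \<alpha> $ i * ?g i u) = (\<alpha> v* matrix_exp (u *\<^sub>R ?A) v* submat \<Lambda> S a) \<bullet> 1"
    unfolding dot_lmul_matrix inner_vec_def[of \<alpha>] by simp
  \<comment> \<open>The formula by \<open>w\<close> is known for positive times, an open set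
    containing \<open>u\<close>, and the derivative at \<open>u\<close> is local.\<close>
  finally show ?thesis
    unfolding S_def[symmetric]
    by (rule has_field_derivative_transform_within_open[where S = "{0<..}"]) (use eq assms(6) in auto)
qed

end
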